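(* Let $(X,d)$ be a metric space and let $\mathcal{S}$ be a bornology on $X$. Suppose $(A_\lambda)$ is a net in $CL(X)$ and $A \in CL(X)$. Then the following statements are equivalent: (i) for all $S \in \mathcal{S}$ and all $f, g \in \mathcal{Z}^+$ with $\inf\{g(x)-f(x) : x \in S\} > 0$, whenever $A \cap B_d(S,g) = \emptyset$, then $A_\lambda \cap B_d(S,f) = \emptyset$ eventually; (ii) $(A_\lambda)$ is $\tau_{\mathcal{S},d}^+$-convergent to $A$.
   Context: $\mathcal{P}_0(X)$ is the family of all nonempty subsets of $X$ and $CL(X)$ the family of all nonempty closed subsets. A bornology on $X$ is a nonempty family $\mathcal{S} \subseteq \mathcal{P}_0(X)$ that is hereditary (closed under taking nonempty subsets), closed under finite unions, and covers $X$. $d(x,A)=\inf\{d(x,a):a\in A\}$. $\mathcal{Z}^+$ is the set of all functions $f:X\to\mathbb{R}$ with $f(x)>0$ for all $x \in X$. For a nonempty $S \subseteq X$ and $f\in\mathcal{Z}^+$, the $f$-enlargement of $S$ is $B_d(S,f)=\bigcup_{x\in S}B_d(x,f(x))$, where $B_d(x,r)$ is the open ball. The topology $\tau_{\mathcal{S},d}^+$ on $\mathcal{P}_0(X)$ is the one induced by the quasi-uniformity with base the sets $[S,\epsilon]^+=\{(A,C)\in \mathcal{P}_0(X)\times\mathcal{P}_0(X): d(x,A)-d(x,C)<\epsilon\ \forall x\in S\}$ ($S\in\mathcal{S}$, $\epsilon>0$); so $(A_\lambda)$ $\tau_{\mathcal{S},d}^+$-converges to $A$ iff for every $S\in\mathcal{S}$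 and $\epsilon>0$, eventually $d(x,A)-d(x,A_\lambda)<\epsilon$ for all $x\in S$. *)

theory Defs
  imports "HOL-Analysis.Analysis"
begin

text \<open>The metric space \<open>X\<close> is a type of class \<open>metric_space\<close>; the distance
  \<open>d(x, A)\<close> is \<open>infdist x A\<close>, which is the usual infimum for every nonempty \<open>A\<close>.\<close>

definition P0 :: "'a set set" where
  "P0 = {A. A \<noteq> {}}"

definition CL :: "'a::topological_space set set" where
  "CL = {A. A \<noteq> {} \<and> closed A}"

definition bornology :: "'a set set \<Rightarrow> bool" where
  "bornology \<S> \<longleftrightarrow>
     \<S> \<noteq> {} \<and> \<S> \<subseteq> P0 \<and>
     (\<forall>S\<in>\<S>. \<forall>T\<in>P0. T \<subseteq> S \<longrightarrow> T \<in> \<S>) \<and>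
     (\<forall>S\<in>\<S>. \<forall>T\<in>\<S>. S \<union> T \<in> \<S>) \<and>
     \<Union>\<S> = UNIV"

definition Zplus :: "('a \<Rightarrow> real) set" where
  "Zplus = {f. \<forall>x. f x > 0}"

definition enlargement :: "'a::metric_space set \<Rightarrow> ('a \<Rightarrow> real) \<Rightarrow> 'a set" where
  "enlargement S f = (\<Union>x\<in>S. ball x (f x))"

definition upper_entourage :: "'a::metric_space set \<Rightarrow> real \<Rightarrow> ('a set \<times> 'a set) set" where
  "upper_entourage S \<epsilon> =
     {(A, C). A \<in> P0 \<and> C \<in> P0 \<and> (\<forall>x\<in>S. infdist x A - infdist x C < \<epsilon>)}"

definition upper_quasi_uniformity :: "'a::metric_space set set \<Rightarrow> ('a set \<times> 'a set) set set" where
  "upper_quasi_uniformity \<S> =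
     {U. U \<subseteq> P0 \<times> P0 \<and> (\<exists>S\<in>\<S>. \<exists>\<epsilon>>0. upper_entourage S \<epsilon> \<subseteq> U)}"

text \<open>The topology of a quasi-uniformity: the neighbourhoods of \<open>A\<close> are the sections
  \<open>U `` {A} = {C. (A, C) \<in> U}\<close>.\<close>

definition upper_topology :: "'a::metric_space set set \<Rightarrow> 'a set topology" where
  "upper_topology \<S> =
     topology (\<lambda>G. G \<subseteq> P0 \<and> (\<forall>A\<in>G. \<exists>U\<in>upper_quasi_uniformity \<S>. U `` {A} \<subseteq> G))"

definition directed_set :: "'i set \<Rightarrow> ('i \<times> 'i) set \<Rightarrow> bool" where
  "directed_set I r \<longleftrightarrow>
     I \<noteq> {} \<and> preorder_on I r \<and> (\<forall>i\<in>I. \<forall>j\<in>I. \<exists>k\<in>I. (i, k) \<in> r \<and> (j, k) \<in> r)"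

definition net_filter :: "'i set \<Rightarrow> ('i \<times> 'i) set \<Rightarrow> 'i filter" where
  "net_filter I r = (INF i\<in>I. principal {j \<in> I. (i, j) \<in> r})"

lemma eventually_net_filter:
  assumes "directed_set I r"
  shows "eventually P (net_filter I r) \<longleftrightarrow> (\<exists>i\<in>I. \<forall>j\<in>I. (i, j) \<in> r \<longrightarrow> P j)"
  unfolding net_filter_def
proof (subst eventually_INF_base)
  show "I \<noteq> {}" using assms by (simp add: directed_set_def)
next
  fix a b assume "a \<in> I" "b \<in> I"
  then obtain k where "k \<in> I" "(a, k) \<in> r" "(b, k) \<in> r"
    using assms unfolding directed_set_def by blast
  moreover have "trans r"
    using assms by (simp add: directed_set_def preorder_on_def)
  ultimately show "\<exists>x\<in>I. principal {j \<in> I. (x, j) \<in> r}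
      \<le> inf (principal {j \<in> I. (a, j) \<in> r}) (principal {j \<in> I. (b, j) \<in> r})"
    by (intro bexI[of _ k]) (auto dest: transD)
qed (auto simp: eventually_principal)

lemma upper_entourage_mono:
  "S \<subseteq> T \<Longrightarrow> \<delta> \<le> \<epsilon> \<Longrightarrow> upper_entourage T \<delta> \<subseteq> upper_entourage S \<epsilon>"
  unfolding upper_entourage_def by fastforce

lemma istopology_upper:
  assumes "bornology \<S>"
  shows "istopology (\<lambda>G. G \<subseteq> P0 \<and> (\<forall>A\<in>G. \<exists>U\<in>upper_quasi_uniformity \<S>. U `` {A} \<subseteq> G))"
    (is "istopology ?L")
proof -
  have inter: "\<exists>W\<in>upper_quasi_uniformity \<S>. W `` {A} \<subseteq> G \<inter> H"
    if G: "\<forall>A\<in>G. \<exists>U\<in>upper_quasi_uniformity \<S>. U `` {A} \<subseteq> G"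
      and H: "\<forall>A\<in>H. \<exists>U\<in>upper_quasi_uniformity \<S>. U `` {A} \<subseteq> H" and A: "A \<in> G \<inter> H"
    for G H A
  proof -
  obtain U V where U: "U \<in> upper_quasi_uniformity \<S>" "U `` {A} \<subseteq> G"
    and V: "V \<in> upper_quasi_uniformity \<S>" "V `` {A} \<subseteq> H"
    using G H A by blast
  obtain S \<delta> T \<epsilon> where S: "S \<in> \<S>" "\<delta> > 0" "upper_entourage S \<delta> \<subseteq> U"
    and T: "T \<in> \<S>" "\<epsilon> > 0" "upper_entourage T \<epsilon> \<subseteq> V"
    using U(1) V(1) unfolding upper_quasi_uniformity_def mem_Collect_eq by meson
  have "S \<union> T \<in> \<S>" using assms S(1) T(1) unfolding bornology_def by blast
  moreover have "upper_entourage (S \<union> T) (min \<delta> \<epsilon>) \<subseteq> U \<inter> V"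
    using S(3) T(3) upper_entourage_mono[of S "S \<union> T" "min \<delta> \<epsilon>" \<delta>]
      upper_entourage_mono[of T "S \<union> T" "min \<delta> \<epsilon>" \<epsilon>] by auto
  moreover have "min \<delta> \<epsilon> > 0" using S(2) T(2) by simp
  moreover have "U \<inter> V \<subseteq> P0 \<times> P0" using U(1) unfolding upper_quasi_uniformity_def by blast
  ultimately have "U \<inter> V \<in> upper_quasi_uniformity \<S>"
    unfolding upper_quasi_uniformity_def by blast
  moreover have "(U \<inter> V) `` {A} \<subseteq> G \<inter> H" using U(2) V(2) by blast
  ultimately show ?thesis by (rule bexI[rotated])
  qed
  have union: "\<exists>U\<in>upper_quasi_uniformity \<S>. U `` {A} \<subseteq> \<Union>\<K>"
    if K: "\<forall>K\<in>\<K>. ?L K" and A: "A \<in> \<Union>\<K>" for \<K> A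
  proof -
    obtain K where "K \<in> \<K>" "A \<in> K" using A by (rule UnionE)
    moreover then obtain U where "U \<in> upper_quasi_uniformity \<S>" "U `` {A} \<subseteq> K"
      using K by meson
    ultimately show ?thesis by (meson Union_upper order_trans)
  qed
  show ?thesis
    unfolding istopology_def
  proof (intro conjI allI impI)
    fix G H assume "?L G" "?L H"
    then show "G \<inter> H \<subseteq> P0" "\<forall>A\<in>G \<inter> H. \<exists>U\<in>upper_quasi_uniformity \<S>. U `` {A} \<subseteq> G \<inter> H"
      using inter[of G H] by (simp_all add: le_infI1)
  next
    fix \<K> assume K: "\<forall>K\<in>\<K>. ?L K"
    then show "\<Union>\<K> \<subseteq> P0" by (simp add: Sup_le_iff)
    show "\<forall>A\<in>\<Union>\<K>. \<exists>U\<in>upper_quasi_uniformity \<S>. U `` {A} \<subseteq> \<Union>\<K>"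
      using union[OF K] by (rule ballI)
  qed
qed

lemma openin_upper_topology:
  assumes "bornology \<S>"
  shows "openin (upper_topology \<S>) G \<longleftrightarrow>
    G \<subseteq> P0 \<and> (\<forall>A\<in>G. \<exists>S\<in>\<S>. \<exists>\<epsilon>>0. upper_entourage S \<epsilon> `` {A} \<subseteq> G)"
proof -
  have "(\<exists>U\<in>upper_quasi_uniformity \<S>. U `` {A} \<subseteq> G) \<longleftrightarrow>
        (\<exists>S\<in>\<S>. \<exists>\<epsilon>>0. upper_entourage S \<epsilon> `` {A} \<subseteq> G)" for A
  proof
    assume "\<exists>S\<in>\<S>. \<exists>\<epsilon>>0. upper_entourage S \<epsilon> `` {A} \<subseteq> G"
    then obtain S \<epsilon> where S: "S \<in> \<S>" "\<epsilon> > 0" "upper_entourage S \<epsilon> `` {A} \<subseteq> G" by blast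
    moreover have "upper_entourage S \<epsilon> \<subseteq> P0 \<times> P0"
      unfolding upper_entourage_def by blast
    ultimately have "upper_entourage S \<epsilon> \<in> upper_quasi_uniformity \<S>"
      unfolding upper_quasi_uniformity_def by blast
    with S(3) show "\<exists>U\<in>upper_quasi_uniformity \<S>. U `` {A} \<subseteq> G" by blast
  next
    assume "\<exists>U\<in>upper_quasi_uniformity \<S>. U `` {A} \<subseteq> G"
    then obtain U where U: "U \<in> upper_quasi_uniformity \<S>" "U `` {A} \<subseteq> G" by (rule bexE)
    then obtain S \<epsilon> where "S \<in> \<S>" "\<epsilon> > 0" "upper_entourage S \<epsilon> \<subseteq> U"
      unfolding upper_quasi_uniformity_def mem_Collect_eq by meson
    moreover then have "upper_entourage S \<epsilon> `` {A} \<subseteq> G" using U(2) by blast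
    ultimately show "\<exists>S\<in>\<S>. \<exists>\<epsilon>>0. upper_entourage S \<epsilon> `` {A} \<subseteq> G" by meson
  qed
  then show ?thesis
    unfolding upper_topology_def topology_inverse'[OF istopology_upper[OF assms]] by simp
qed

lemma topspace_upper_topology:
  assumes "bornology \<S>"
  shows "topspace (upper_topology \<S>) = P0"
proof
  show "topspace (upper_topology \<S>) \<subseteq> P0"
    unfolding topspace_def openin_upper_topology[OF assms] by blast
  obtain S where "S \<in> \<S>" using assms unfolding bornology_def by (meson ex_in_conv)
  then have "openin (upper_topology \<S>) P0"
    unfolding openin_upper_topology[OF assms] upper_entourage_def
    by (auto intro!: bexI[of _ S] exI[of _ "1::real"])
  then show "P0 \<subseteq> topspace (upper_topology \<S>)" by (rule openin_subset)
qed

lemma limitin_upper_topology: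
  assumes "bornology \<S>" and A: "A \<in> P0" and ev: "\<forall>\<^sub>F i in F. B i \<in> P0"
  shows "limitin (upper_topology \<S>) B A F \<longleftrightarrow>
    (\<forall>S\<in>\<S>. \<forall>\<epsilon>>0. \<forall>\<^sub>F i in F. \<forall>x\<in>S. infdist x A - infdist x (B i) < \<epsilon>)"
proof
  assume L: "limitin (upper_topology \<S>) B A F"
  show "\<forall>S\<in>\<S>. \<forall>\<epsilon>>0. \<forall>\<^sub>F i in F. \<forall>x\<in>S. infdist x A - infdist x (B i) < \<epsilon>"
  proof (intro ballI allI impI)
    fix S and \<epsilon> :: real assume S: "S \<in> \<S>" and \<epsilon>: "\<epsilon> > 0"
    define V where "V = upper_entourage S \<epsilon> `` {A}"
    define G where "G = {C \<in> P0. \<exists>\<delta>>0. upper_entourage S \<delta> `` {C} \<subseteq> V}"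
    have "openin (upper_topology \<S>) G"
      unfolding openin_upper_topology[OF assms(1)]
    proof (intro conjI ballI)
      show "G \<subseteq> P0" unfolding G_def by blast
    next
      fix C assume "C \<in> G"
      then obtain \<delta> where \<delta>: "\<delta> > 0" "upper_entourage S \<delta> `` {C} \<subseteq> V" "C \<in> P0"
        unfolding G_def by blast
      have "upper_entourage S (\<delta>/2) `` {C} \<subseteq> G"
      proof
        fix D assume D: "D \<in> upper_entourage S (\<delta>/2) `` {C}"
        have "upper_entourage S (\<delta>/2) `` {D} \<subseteq> upper_entourage S \<delta> `` {C}"
        proof
          fix E assume "E \<in> upper_entourage S (\<delta>/2) `` {D}"
          then show "E \<in> upper_entourage S \<delta> `` {C}"
            using D unfolding upper_entourage_def by fastforce
        qed
        then have "upper_entourage S (\<delta>/2) `` {D} \<subseteq> V" using \<delta>(2) by blast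
        moreover have "D \<in> P0" using D unfolding upper_entourage_def by blast
        ultimately show "D \<in> G" using \<delta>(1) unfolding G_def
          by (auto intro!: exI[of _ "\<delta>/2"])
      qed
      then show "\<exists>S\<in>\<S>. \<exists>\<epsilon>>0. upper_entourage S \<epsilon> `` {C} \<subseteq> G"
        using S \<delta>(1) by (intro bexI[of _ S] exI[of _ "\<delta>/2"]) auto
    qed
    moreover have "A \<in> G" unfolding G_def V_def using A \<epsilon> by blast
    ultimately have "\<forall>\<^sub>F i in F. B i \<in> G" using L unfolding limitin_def by blast
    moreover have "G \<subseteq> V"
    proof
      fix C assume "C \<in> G"
      then obtain \<delta> where "\<delta> > 0" "upper_entourage S \<delta> `` {C} \<subseteq> V" "C \<in> P0"
        unfolding G_def by blast
      then show "C \<in> V" unfolding upper_entourage_def by auto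
    qed
    ultimately have "\<forall>\<^sub>F i in F. B i \<in> V" by (auto elim: eventually_mono)
    then show "\<forall>\<^sub>F i in F. \<forall>x\<in>S. infdist x A - infdist x (B i) < \<epsilon>"
      by (rule eventually_mono) (auto simp: V_def upper_entourage_def)
  qed
next
  assume R: "\<forall>S\<in>\<S>. \<forall>\<epsilon>>0. \<forall>\<^sub>F i in F. \<forall>x\<in>S. infdist x A - infdist x (B i) < \<epsilon>"
  show "limitin (upper_topology \<S>) B A F"
    unfolding limitin_def topspace_upper_topology[OF assms(1)] openin_upper_topology[OF assms(1)]
  proof (intro conjI allI impI A)
    fix G assume "(G \<subseteq> P0 \<and> (\<forall>A\<in>G. \<exists>S\<in>\<S>. \<exists>\<epsilon>>0. upper_entourage S \<epsilon> `` {A} \<subseteq> G)) \<and> A \<in> G"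
    then obtain S \<epsilon> where S: "S \<in> \<S>" "\<epsilon> > 0" "upper_entourage S \<epsilon> `` {A} \<subseteq> G" by blast
    then have "\<forall>\<^sub>F i in F. \<forall>x\<in>S. infdist x A - infdist x (B i) < \<epsilon>" using R by blast
    with ev show "\<forall>\<^sub>F i in F. B i \<in> G"
      by eventually_elim (use S(3) A in \<open>auto simp: upper_entourage_def\<close>)
  qed
qed

end

theory Submission
  imports Defs
begin

text \<open>A nonempty set misses the enlargement of \<open>S\<close> by \<open>f\<close> exactly when its distance function
  dominates \<open>f\<close> on \<open>S\<close>, so (i) compares distance functions and follows from (ii). For the
  converse, the points of \<open>S\<close> closer than \<open>\<epsilon>\<close> to \<open>A\<close> are harmless. On the remaining points apply
  (i) with \<open>g = d(\<cdot>, A)\<close> and \<open>f = g - \<epsilon>/2\<close>, both positive there.\<close>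

text \<open>Balls are open, so \<open>A\<close> misses \<open>ball x (f x)\<close> iff
  \<open>f x\<close> is a lower bound of the distances from \<open>x\<close> to points of
  \<open>A\<close>, i.e. at most their infimum.\<close>

lemma disjoint_enlargement_iff:
  assumes "A \<noteq> {}"
  shows "A \<inter> enlargement S f = {} \<longleftrightarrow> (\<forall>x\<in>S. f x \<le> infdist x A)"
proof -
  have "f x \<le> infdist x A \<longleftrightarrow> (\<forall>a\<in>A. f x \<le> dist x a)" for x
    unfolding infdist_notempty[OF assms]
    using assms by (subst le_cINF_iff) (auto intro!: bdd_belowI2[of _ 0])
  then show ?thesis
    unfolding enlargement_def by (auto simp: disjoint_iff not_less)
qed

theorem theorem4p1:
  fixes \<S> :: "'a::metric_space set set"
    and I :: "'i set" and r :: "('i \<times> 'i) set"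
    and A\<^sub>n :: "'i \<Rightarrow> 'a set" and A :: "'a set"
  assumes "bornology \<S>"
    and "directed_set I r"
    and "\<And>i. i \<in> I \<Longrightarrow> A\<^sub>n i \<in> CL"
    and "A \<in> CL"
  shows "(\<forall>S\<in>\<S>. \<forall>f\<in>Zplus. \<forall>g\<in>Zplus.
            (INF x\<in>S. ereal (g x - f x)) > 0 \<longrightarrow>
            A \<inter> enlargement S g = {} \<longrightarrow>
            (\<forall>\<^sub>F i in net_filter I r. A\<^sub>n i \<inter> enlargement S f = {}))
     \<longleftrightarrow> limitin (upper_topology \<S>) A\<^sub>n A (net_filter I r)"
    (is "?miss \<longleftrightarrow> _")
proof -
  have "A \<noteq> {}" using assms(4) by (simp add: CL_def)
  \<comment> \<open>Values outside \<open>I\<close> are unconstrained and may be empty, where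
    \<open>infdist\<close> defaults to 0; the filter sees only indices in \<open>I\<close>.\<close>
  have nonempty: "\<forall>\<^sub>F i in net_filter I r. A\<^sub>n i \<noteq> {}"
    using assms(2,3) unfolding eventually_net_filter[OF assms(2)] directed_set_def CL_def
    by blast
  have "?miss \<longleftrightarrow> (\<forall>S\<in>\<S>. \<forall>\<epsilon>>0. \<forall>\<^sub>F i in net_filter I r.
      \<forall>x\<in>S. infdist x A - infdist x (A\<^sub>n i) < \<epsilon>)" (is "_ \<longleftrightarrow> ?conv")
  proof
    assume miss: ?miss
    show ?conv
    proof (intro ballI allI impI)
      fix S and \<epsilon> :: real assume S: "S \<in> \<S>" and \<epsilon>: "\<epsilon> > 0"
      define T where "T = {x \<in> S. \<epsilon> \<le> infdist x A}"
      \<comment> \<open>\<open>Zplus\<close> demands positivity on the whole space: the maximum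
        keeps \<open>g\<close> at least \<open>\<epsilon>\<close> everywhere without changing the
        distance to \<open>A\<close> on \<open>T\<close>.\<close>
      define g where "g = (\<lambda>x. max \<epsilon> (infdist x A))"
      define f where "f = (\<lambda>x. g x - \<epsilon> / 2)"
      have far: "\<forall>\<^sub>F i in net_filter I r. \<forall>x\<in>T. f x \<le> infdist x (A\<^sub>n i)"
      \<comment> \<open>A bornology has only nonempty members, so (i) applies to \<open>T\<close>
        only if \<open>T\<close> is nonempty; otherwise the claim is vacuous.\<close>
      proof (cases "T = {}")
        case False
        have "T \<in> P0" "T \<subseteq> S"
          using False by (auto simp: P0_def T_def)
        then have "T \<in> \<S>"
          using assms(1) S by (simp add: bornology_def)
        moreover have "f \<in> Zplus" "g \<in> Zplus"
          using \<epsilon> by (auto simp: Zplus_def f_def g_def)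
        moreover have "(INF x\<in>T. ereal (g x - f x)) > 0"
          using \<epsilon> False by (simp add: f_def)
        moreover have "A \<inter> enlargement T g = {}"
          unfolding disjoint_enlargement_iff[OF \<open>A \<noteq> {}\<close>] by (simp add: T_def g_def)
        ultimately have "\<forall>\<^sub>F i in net_filter I r. A\<^sub>n i \<inter> enlargement T f = {}"
          using miss by blast
        with nonempty show ?thesis
          by eventually_elim (simp add: disjoint_enlargement_iff)
      qed simp
      then show "\<forall>\<^sub>F i in net_filter I r. \<forall>x\<in>S. infdist x A - infdist x (A\<^sub>n i) < \<epsilon>"
      proof eventually_elim
        case (elim i)
        show ?case
        proof
          fix x assume "x \<in> S"
          show "infdist x A - infdist x (A\<^sub>n i) < \<epsilon>"
          proof (cases "x \<in> T")
            case True
            then show ?thesis using elim \<epsilon> by (auto simp: f_def g_def T_def)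
          next
            case False
            then show ?thesis
              \<comment> \<open>Off \<open>T\<close> the first distance is already below
                \<open>\<epsilon>\<close>, and the subtracted one is nonnegative.\<close>
              using \<open>x \<in> S\<close> infdist_nonneg[of x "A\<^sub>n i"] by (simp add: T_def)
          qed
        qed
      qed
    qed
  next
    assume conv: ?conv
    show ?miss
    proof (intro ballI impI)
      fix S and f g :: "'a \<Rightarrow> real"
      assume S: "S \<in> \<S>" and gap: "(INF x\<in>S. ereal (g x - f x)) > 0"
        and "A \<inter> enlargement S g = {}"
      then have g: "\<forall>x\<in>S. g x \<le> infdist x A"
        by (simp add: disjoint_enlargement_iff[OF \<open>A \<noteq> {}\<close>])
      \<comment> \<open>A real number strictly below the extended-real infimum is a uniform gap
        between \<open>f\<close> and \<open>g\<close> on \<open>S\<close>.\<close>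
      obtain \<epsilon> where \<epsilon>: "0 < ereal \<epsilon>" "ereal \<epsilon> < (INF x\<in>S. ereal (g x - f x))"
        using ereal_dense2[OF gap] by blast
      then have fg: "\<epsilon> < g x - f x" if "x \<in> S" for x
        using less_INF_D[OF \<epsilon>(2) that] by simp
      have "\<forall>\<^sub>F i in net_filter I r. \<forall>x\<in>S. infdist x A - infdist x (A\<^sub>n i) < \<epsilon>"
        using conv S \<epsilon>(1) by simp
      with nonempty show "\<forall>\<^sub>F i in net_filter I r. A\<^sub>n i \<inter> enlargement S f = {}"
      proof eventually_elim
        case (elim i)
        show ?case
          unfolding disjoint_enlargement_iff[OF elim(1)]
        proof
          fix x assume "x \<in> S"
          then have "infdist x A - infdist x (A\<^sub>n i) < \<epsilon>" "g x \<le> infdist x A"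
            using elim(2) g by blast+
          \<comment> \<open>The gap absorbs the error: \<open>f x < g x - \<epsilon> \<le> infdist x
            A - \<epsilon> < infdist x (A\<^sub>n i)\<close>.\<close>
          then show "f x \<le> infdist x (A\<^sub>n i)"
            using fg[OF \<open>x \<in> S\<close>] by linarith
        qed
      qed
    qed
  qed
  also have "\<dots> \<longleftrightarrow> limitin (upper_topology \<S>) A\<^sub>n A (net_filter I r)"
    using \<open>A \<noteq> {}\<close> nonempty
    by (intro limitin_upper_topology[OF assms(1), symmetric]) (simp_all add: P0_def)
  finally show ?thesis .
qed

end
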